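(* Let $\alpha$ be a nonzero complex number, $\lambda$ a complex number, and $n,k\ge 0$ integers. Then $$y_{1,\alpha}^{*}(n,k;\lambda)=\frac{1}{k!}\sum_{\ell=0}^{k}\sum_{j=0}^{\ell}\binom{\ell}{j}\alpha^{k-\ell}S_{1}(k,\ell)\lambda^{j}j^{n}$$ and also $$y_{1,\alpha}^{*}(n,k;\lambda)=\frac{1}{k!}\sum_{\ell=0}^{k}\sum_{j=0}^{\ell}\binom{k}{\ell}\alpha^{\ell-j}\lambda^{j}j^{n}(1)_{k-\ell,\alpha}S_{1}(\ell,j).$$
   Context: For an element $x$ of a commutative $\mathbb{C}$-algebra (e.g. a number or a formal power series in $t$), the degenerate falling factorial is $(x)_{0,\alpha}=1$ and $(x)_{n,\alpha}=x(x-\alpha)(x-2\alpha)\cdots(x-(n-1)\alpha)$ for $n\ge 1$. The falling factorial is $(x)_0=1$, $(x)_n=x(x-1)\cdots(x-n+1)$ for $n\ge1$. The (signed) Stirling numbers of the first kind $S_1(n,k)$ are defined by $(x)_n=\sum_{k=0}^{n}S_1(n,k)x^k$. The new type degenerate Simsek numbers $y_{1,\alpha}^{*}(n,k;\lambda)$ are defined by the generating function $$\frac{(\lambda e^t+1)_{k,\alpha}}{k!}=\sum_{n=0}^{\infty}y_{1,\alpha}^{*}(n,k;\lambda)\frac{t^n}{n!}.$$ Convention: $0^0=1$. *)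

theory Defs
  imports
    "HOL-Computational_Algebra.Polynomial"
    "HOL-Computational_Algebra.Formal_Power_Series"
begin

text \<open>
  The step \<open>\<alpha>\<close> is taken in the same ring as \<open>x\<close>; for power series a scalar step is embedded
  by \<^const>\<open>fps_const\<close>.
\<close>

definition degenerate_ffact :: "'a::comm_ring_1 \<Rightarrow> nat \<Rightarrow> 'a \<Rightarrow> 'a" where
  "degenerate_ffact x n \<alpha> = (\<Prod>i<n. x - of_nat i * \<alpha>)"

definition ffact :: "'a::comm_ring_1 \<Rightarrow> nat \<Rightarrow> 'a" where
  "ffact x n = (\<Prod>i<n. x - of_nat i)"

text \<open>
  Signed Stirling numbers of the first kind, as the coefficients of the falling factorial of the
  polynomial indeterminate \<open>[:0, 1:]\<close>. (The library constant \<open>stirling\<close> is the unsigned version.)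
\<close>

definition S1 :: "nat \<Rightarrow> nat \<Rightarrow> int" where
  "S1 n k = coeff (ffact [:0, 1:] n) k"

text \<open>\<open>n!\<close> times the coefficient of \<open>t\<^sup>n\<close> in the generating function.\<close>

definition degenerate_simsek :: "complex \<Rightarrow> nat \<Rightarrow> nat \<Rightarrow> complex \<Rightarrow> complex" where
  "degenerate_simsek \<alpha> n k \<mu> =
     fact n * fps_nth (fps_const (1 / fact k) *
       degenerate_ffact (fps_const \<mu> * fps_exp 1 + 1) k (fps_const \<alpha>)) n"

lemma degree_ffact: "degree (ffact [:0, 1:] n :: int poly) \<le> n"
proof (induction n)
  case (Suc n)
  have "degree ([:0, 1:] - of_nat n :: int poly) \<le> 1"
    by (simp add: of_nat_poly)
  then show ?case
    using Suc degree_mult_le[of "ffact [:0, 1:] n :: int poly" "[:0, 1:] - of_nat n"]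
    unfolding ffact_def by simp
qed (simp add: ffact_def)

lemma ffact_eq_sum_S1:
  fixes x :: "'a::comm_ring_1"
  shows "ffact x n = (\<Sum>k\<le>n. of_int (S1 n k) * x ^ k)"
proof -
  have *: "poly (map_poly of_int (ffact [:0, 1:] n)) x = ffact x n"
  proof (induction n)
    case (Suc n)
    have "(ffact [:0, 1:] (Suc n) :: int poly) =
        pCons 0 (ffact [:0, 1:] n) - smult (of_nat n) (ffact [:0, 1:] n)"
      by (simp add: ffact_def algebra_simps of_nat_poly)
    then have "map_poly of_int (ffact [:0, 1:] (Suc n) :: int poly) =
        (pCons 0 (map_poly of_int (ffact [:0, 1:] n)) -
         smult (of_nat n) (map_poly of_int (ffact [:0, 1:] n)) :: 'a poly)"
      by (intro poly_eqI) (simp add: coeff_map_poly coeff_pCons split: nat.split)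
    then have "poly (map_poly of_int (ffact [:0, 1:] (Suc n) :: int poly)) x =
        x * ffact x n - of_nat n * ffact x n"
      using Suc by simp
    also have "\<dots> = ffact x (Suc n)"
      by (simp add: ffact_def algebra_simps)
    finally show ?case .
  qed (simp add: ffact_def)
  have "degree (map_poly of_int (ffact [:0, 1:] n) :: 'a poly) \<le> n"
    using degree_ffact[of n] by (intro degree_le) (simp add: coeff_map_poly coeff_eq_0)
  then have "poly (map_poly of_int (ffact [:0, 1:] n)) x =
      (\<Sum>k\<le>n. of_int (S1 n k) * x ^ k)"
    unfolding poly_altdef
    by (intro sum.mono_neutral_cong_left) (auto simp: S1_def coeff_map_poly intro!: le_degree)
  with * show ?thesis by simp
qed

lemma degenerate_simsek_gf:
  "fps_const (1 / fact k) * degenerate_ffact (fps_const \<mu> * fps_exp 1 + 1) k (fps_const \<alpha>) =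
     Abs_fps (\<lambda>n. degenerate_simsek \<alpha> n k \<mu> / fact n)"
  by (rule fps_ext) (simp add: degenerate_simsek_def)

end

theory Submission
  imports Defs
begin

text \<open>
  Expanding the degenerate falling factorial \<open>(x)\<^sub>k\<close> in powers of \<open>x\<close> is the homogenized form of the
  definition of \<open>S1\<close>. Both formulas come from \<open>x = \<mu> e\<^sup>t + 1\<close>: either apply that expansion
  to \<open>x\<close> itself and then the binomial theorem, or first split \<open>(\<mu> e\<^sup>t + 1)\<^sub>k\<close> by the Vandermonde
  identity and then expand \<open>(\<mu> e\<^sup>t)\<^sub>l\<close>. In both cases only powers of \<open>\<mu> e\<^sup>t\<close> remain, whose
  coefficients are known.
\<close>

lemma degenerate_ffact_0 [simp]: "degenerate_ffact x 0 a = 1"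
  by (simp add: degenerate_ffact_def)

lemma degenerate_ffact_Suc:
  "degenerate_ffact x (Suc n) a = degenerate_ffact x n a * (x - of_nat n * a)"
  by (simp add: degenerate_ffact_def)

lemma S1_0: "S1 0 l = (if l = 0 then 1 else 0)"
  by (simp add: S1_def ffact_def)

text \<open>Multiplying \<open>ffact [:0, 1:] n\<close> by X - n shifts its coefficients up by one,
  leaving nothing at index 0, and subtracts n times the old ones.\<close>

lemma S1_Suc: "S1 (Suc n) l = (case l of 0 \<Rightarrow> 0 | Suc m \<Rightarrow> S1 n m) - int n * S1 n l"
proof -
  have "(ffact [:0, 1:] (Suc n) :: int poly) =
      pCons 0 (ffact [:0, 1:] n) - smult (of_nat n) (ffact [:0, 1:] n)"
    by (simp add: ffact_def algebra_simps of_nat_poly)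
  then show ?thesis
    by (simp add: S1_def coeff_pCons split: nat.split)
qed

lemma S1_eq_0: "n < l \<Longrightarrow> S1 n l = 0"
  using degree_ffact[of n] by (simp add: S1_def coeff_eq_0)

text \<open>Induction through \<open>S1_Suc\<close> replaces the usual substitution x/a, which would
  require dividing by \<open>a\<close>.\<close>

lemma degenerate_ffact_eq_sum_S1:
  fixes x a :: "'a::comm_ring_1"
  shows "degenerate_ffact x n a = (\<Sum>l\<le>n. of_int (S1 n l) * a ^ (n - l) * x ^ l)"
proof (induction n)
  case 0
  then show ?case by (simp add: S1_0)
next
  case (Suc n)
  let ?s = "\<lambda>l. of_int (S1 n l) * a ^ (n - l) * x ^ l"
  have "(\<Sum>l\<le>Suc n. of_int (S1 (Suc n) l) * a ^ (Suc n - l) * x ^ l) =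
      (\<Sum>l\<le>Suc n. of_int (case l of 0 \<Rightarrow> 0 | Suc m \<Rightarrow> S1 n m) * a ^ (Suc n - l) * x ^ l) -
      (\<Sum>l\<le>Suc n. of_nat n * of_int (S1 n l) * a ^ (Suc n - l) * x ^ l)"
    by (simp only: S1_Suc of_int_diff of_int_mult of_int_of_nat_eq left_diff_distrib sum_subtractf)
  \<comment> \<open>The term at 0 vanishes; reindexing the others leaves a factor
    \<open>x\<close>.\<close>
  also have "(\<Sum>l\<le>Suc n. of_int (case l of 0 \<Rightarrow> 0 | Suc m \<Rightarrow> S1 n m) * a ^ (Suc n - l) * x ^ l) =
      (\<Sum>l\<le>n. ?s l) * x"
    by (subst sum.atMost_Suc_shift) (simp add: sum_distrib_left mult_ac)
  \<comment> \<open>The top term vanishes since \<open>S1 n (Suc n) = 0\<close>; every other term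
    has a spare factor \<open>a\<close>.\<close>
  also have "(\<Sum>l\<le>Suc n. of_nat n * of_int (S1 n l) * a ^ (Suc n - l) * x ^ l) =
      (\<Sum>l\<le>n. ?s l) * (of_nat n * a)"
    by (simp add: S1_eq_0 sum_distrib_left Suc_diff_le mult_ac)
  finally show ?case
    by (simp add: degenerate_ffact_Suc Suc.IH right_diff_distrib)
qed

text \<open>As x + y - n a = (x - l a) + (y - (n - l) a), passing to n + 1 raises one of the two
  indices in each term; Pascal's rule collects the results.\<close>

lemma degenerate_ffact_add:
  fixes x y a :: "'a::comm_ring_1"
  shows "degenerate_ffact (x + y) n a =
    (\<Sum>l\<le>n. of_nat (n choose l) * degenerate_ffact x l a * degenerate_ffact y (n - l) a)"
proof (induction n)
  case 0
  then show ?case by simp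
next
  case (Suc n)
  let ?D = "\<lambda>x l. degenerate_ffact x l a"
  have "(\<Sum>l\<le>Suc n. of_nat (Suc n choose l) * ?D x l * ?D y (Suc n - l)) =
      ?D y (Suc n) + ((\<Sum>l\<le>n. of_nat (n choose l) * ?D x (Suc l) * ?D y (n - l)) +
      (\<Sum>l\<le>n. of_nat (n choose Suc l) * ?D x (Suc l) * ?D y (n - l)))"
    by (subst sum.atMost_Suc_shift) (simp add: algebra_simps sum.distrib)
  \<comment> \<open>The isolated term is the one at index 0, so undoing the shift reabsorbs
    it.\<close>
  also have "?D y (Suc n) + (A + (\<Sum>l\<le>n. of_nat (n choose Suc l) * ?D x (Suc l) * ?D y (n - l))) =
      A + (\<Sum>l\<le>Suc n. of_nat (n choose l) * ?D x l * ?D y (Suc n - l))" for A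
    by (subst sum.atMost_Suc_shift) simp
  also have "(\<Sum>l\<le>Suc n. of_nat (n choose l) * ?D x l * ?D y (Suc n - l)) =
      (\<Sum>l\<le>n. of_nat (n choose l) * ?D x l * ?D y (Suc (n - l)))"
    by (simp add: Suc_diff_le binomial_eq_0)
  also have "(\<Sum>l\<le>n. of_nat (n choose l) * ?D x (Suc l) * ?D y (n - l)) + \<dots> =
      (\<Sum>l\<le>n. of_nat (n choose l) * ?D x l * ?D y (n - l) * (x + y - of_nat n * a))"
    unfolding sum.distrib [symmetric]
  proof (rule sum.cong)
    fix l assume "l \<in> {..n}"
    then have "(of_nat n :: 'a) = of_nat l + of_nat (n - l)"
      by (simp flip: of_nat_add)
    then show "of_nat (n choose l) * ?D x (Suc l) * ?D y (n - l) +
        of_nat (n choose l) * ?D x l * ?D y (Suc (n - l)) =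
        of_nat (n choose l) * ?D x l * ?D y (n - l) * (x + y - of_nat n * a)"
      by (simp only: degenerate_ffact_Suc) (simp add: algebra_simps)
  qed simp
  finally show ?case
    by (simp add: degenerate_ffact_Suc Suc.IH sum_distrib_right)
qed

lemma degenerate_ffact_fps_const:
  "degenerate_ffact (fps_const x) n (fps_const a) = fps_const (degenerate_ffact x n a)"
  by (induction n) (simp_all add: degenerate_ffact_Suc fps_of_nat [symmetric])

text \<open>The j-th power of c e^t is c^j e^(jt); at j = n = 0 the convention 0^0 = 1 gives the
  correct constant term.\<close>

lemma fps_nth_fps_const_mult_fps_exp_power:
  fixes c :: "'a::field_char_0"
  shows "fps_nth ((fps_const c * fps_exp 1) ^ j) n = c ^ j * of_nat j ^ n / fact n"
  by (simp add: power_mult_distrib fps_exp_power_mult fps_const_power)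

lemma degenerate_simsek_eq_nth:
  "degenerate_simsek \<alpha> n k \<mu> =
    1 / fact k * (fact n *
      fps_nth (degenerate_ffact (fps_const \<mu> * fps_exp 1 + 1) k (fps_const \<alpha>)) n)"
  by (simp add: degenerate_simsek_def)

theorem theorem2p3:
  fixes \<alpha> \<mu> :: complex and n k :: nat
  assumes "\<alpha> \<noteq> 0"
  shows "degenerate_simsek \<alpha> n k \<mu> =
           1 / fact k * (\<Sum>l=0..k. \<Sum>j=0..l.
             of_nat (l choose j) * \<alpha> ^ (k - l) * of_int (S1 k l) * \<mu> ^ j * of_nat j ^ n)
       \<and> degenerate_simsek \<alpha> n k \<mu> =
           1 / fact k * (\<Sum>l=0..k. \<Sum>j=0..l.
             of_nat (k choose l) * \<alpha> ^ (l - j) * \<mu> ^ j * of_nat j ^ n *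
             degenerate_ffact 1 (k - l) \<alpha> * of_int (S1 l j))"
proof
  let ?e = "fps_const \<mu> * fps_exp 1 :: complex fps"
  let ?D = "degenerate_ffact (?e + 1) k (fps_const \<alpha>)"
  \<comment> \<open>Flipping \<open>fps_const_mult\<close> splits the scalars into constant series,
    which \<open>mult_ac\<close> can align.\<close>
  have "?D = (\<Sum>l\<le>k. \<Sum>j\<le>l.
      fps_const (of_nat (l choose j) * \<alpha> ^ (k - l) * of_int (S1 k l)) * ?e ^ j)"
    by (simp add: degenerate_ffact_eq_sum_S1 binomial_ring sum_distrib_left fps_const_power
        fps_of_nat [symmetric] fps_of_int [symmetric] mult_ac flip: fps_const_mult)
  then have "fact n * fps_nth ?D n = (\<Sum>l=0..k. \<Sum>j=0..l.
      of_nat (l choose j) * \<alpha> ^ (k - l) * of_int (S1 k l) * \<mu> ^ j * of_nat j ^ n)"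
    by (simp add: fps_sum_nth fps_nth_fps_const_mult_fps_exp_power sum_distrib_left
        atLeast0AtMost mult.assoc)
  then show "degenerate_simsek \<alpha> n k \<mu> =
      1 / fact k * (\<Sum>l=0..k. \<Sum>j=0..l.
        of_nat (l choose j) * \<alpha> ^ (k - l) * of_int (S1 k l) * \<mu> ^ j * of_nat j ^ n)"
    by (simp only: degenerate_simsek_eq_nth)
  have "degenerate_ffact 1 m (fps_const \<alpha>) = fps_const (degenerate_ffact 1 m \<alpha>)" for m
    using degenerate_ffact_fps_const [of 1 m \<alpha>] by simp
  \<comment> \<open>Fixing \<open>?e\<close> in the Stirling expansion keeps the factors
    \<open>degenerate_ffact 1 (k - l)\<close> intact; they leave the sum as scalars.\<close>
  then have "?D = (\<Sum>l\<le>k. \<Sum>j\<le>l. fps_const (of_nat (k choose l) * \<alpha> ^ (l - j) *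
      degenerate_ffact 1 (k - l) \<alpha> * of_int (S1 l j)) * ?e ^ j)"
    by (simp add: degenerate_ffact_add degenerate_ffact_eq_sum_S1 [of ?e] sum_distrib_left
        sum_distrib_right fps_const_power fps_of_nat [symmetric] fps_of_int [symmetric] mult_ac
        flip: fps_const_mult)
  then have "fact n * fps_nth ?D n = (\<Sum>l=0..k. \<Sum>j=0..l.
      of_nat (k choose l) * \<alpha> ^ (l - j) * \<mu> ^ j * of_nat j ^ n *
      degenerate_ffact 1 (k - l) \<alpha> * of_int (S1 l j))"
    by (simp add: fps_sum_nth fps_nth_fps_const_mult_fps_exp_power sum_distrib_left
        atLeast0AtMost mult_ac)
  then show "degenerate_simsek \<alpha> n k \<mu> =
      1 / fact k * (\<Sum>l=0..k. \<Sum>j=0..l.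
        of_nat (k choose l) * \<alpha> ^ (l - j) * \<mu> ^ j * of_nat j ^ n *
        degenerate_ffact 1 (k - l) \<alpha> * of_int (S1 l j))"
    by (simp only: degenerate_simsek_eq_nth)
qed

end
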